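(* Let $(S,+)$ be a semigroup (not necessarily commutative). Then the collection of all finite FS-big subsets of $S$ is partition regular: if $A\subseteq S$ is finite FS-big and $A=\bigcup_{i=1}^r B_i$ for some $r\in\mathbb{N}$, then some $B_i$ is finite FS-big.
   Context: For a finite sequence $\langle x_t\rangle_{t=1}^k$ in $S$ and a nonempty $F\subseteq\{1,\dots,k\}$, $\sum_{t\in F}x_t$ denotes the sum of the $x_t$, $t\in F$, taken in increasing order of indices. The sequence satisfies uniqueness of finite sums if whenever $F,H$ are nonempty subsets of $\{1,\dots,k\}$ with $\sum_{t\in F}x_t=\sum_{t\in H}x_t$, then $F=H$. A subset $A\subseteq S$ is $k$-summable if there is a sequence $\langle x_t\rangle_{t=1}^k$ in $S$ satisfying uniqueness of finite sums with $\sum_{t\in F}x_t\in A$ for every nonempty $F\subseteq\{1,\dots,k\}$. $A$ is finite FS-big if it is $k$-summable for every positive integer $k$. A collection $\mathcal S$ of sets is partition regular if whenever $A\in\mathcal S$ is partitioned into finitely many sets, at least one of them belongs to $\mathcal S$. *)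

theory Defs
  imports Main "HOL-Library.Disjoint_Sets"
begin

text \<open>A semigroup need not have a neutral element, so the sum starts from the term with the
  smallest index; it is meaningful only for finite nonempty \<open>F\<close>.\<close>

definition ordered_sum :: "(nat \<Rightarrow> 'a::semigroup_add) \<Rightarrow> nat set \<Rightarrow> 'a" where
  "ordered_sum x F =
     (let ts = sorted_list_of_set F in foldl (\<lambda>s t. s + x t) (x (hd ts)) (tl ts))"

text \<open>A finite sequence of length \<open>k\<close> is represented by a function on \<open>nat\<close> of which only the
  values at \<open>1, \<dots>, k\<close> are used.\<close>

definition unique_finite_sums :: "nat \<Rightarrow> (nat \<Rightarrow> 'a::semigroup_add) \<Rightarrow> bool" where
  "unique_finite_sums k x \<longleftrightarrow>
     (\<forall>F H. F \<noteq> {} \<longrightarrow> F \<subseteq> {1..k} \<longrightarrow> H \<noteq> {} \<longrightarrow> H \<subseteq> {1..k} \<longrightarrow>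
        ordered_sum x F = ordered_sum x H \<longrightarrow> F = H)"

definition k_summable :: "nat \<Rightarrow> 'a::semigroup_add set \<Rightarrow> bool" where
  "k_summable k A \<longleftrightarrow>
     (\<exists>x. unique_finite_sums k x \<and>
        (\<forall>F. F \<noteq> {} \<longrightarrow> F \<subseteq> {1..k} \<longrightarrow> ordered_sum x F \<in> A))"

definition finite_FS_big :: "'a::semigroup_add set \<Rightarrow> bool" where
  "finite_FS_big A \<longleftrightarrow> (\<forall>k\<ge>1. k_summable k A)"

definition partition_regular :: "'a set set \<Rightarrow> bool" where
  "partition_regular \<S> \<longleftrightarrow>
     (\<forall>A\<in>\<S>. \<forall>P. finite P \<longrightarrow> partition_on A P \<longrightarrow> (\<exists>B\<in>P. B \<in> \<S>))"

end

theory Submission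
  imports Defs "HOL-Library.Ramsey"
begin

text \<open>
  It suffices to find, for every finite colouring of the subsets of a long interval, nonempty
  blocks \<open>D\<^sub>1 < \<dots> < D\<^sub>k\<close> all of whose unions have the same colour: the sums over the blocks of a
  long sequence in \<open>A\<close> then form the required sequence, without any use of commutativity. By
  Ramsey's theorem we may assume that the colour of a set depends only on its cardinality. Hence
  the order of the blocks is irrelevant, only their sizes matter, and these are provided by the
  finite unions theorem for disjoint sets. The latter follows by iterating Hilbert's cube lemma:
  this yields disjoint sets such that the colour of a union depends only on its largest index, and
  the pigeonhole principle finishes the proof.
\<close>

section \<open>Finite unions of disjoint sets\<close>

text \<open>Induction on \<open>m\<close>: append an interval starting at \<open>N\<close> to the
  subsets of \<open>{..<N}\<close>. Two lengths \<open>i < j\<close> induce the same colouring of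
  these subsets. The shorter interval goes into the base, and the difference of the two becomes the
  new direction.\<close>

lemma hilbert_cube_disjoint_sets:
  fixes m :: nat
  shows "\<exists>N. \<forall>c :: nat set \<Rightarrow> nat. (\<forall>F. c F < r) \<longrightarrow>
     (\<exists>A D. A \<noteq> {} \<and> A \<subseteq> {..<N} \<and> (\<forall>i<m. D i \<noteq> {} \<and> D i \<subseteq> {..<N} \<and> A \<inter> D i = {}) \<and>
        disjoint_family_on D {..<m} \<and> (\<forall>I\<subseteq>{..<m}. c (A \<union> \<Union>(D ` I)) = c A))"
proof (induction m)
  case 0
  have "{0} \<noteq> ({} :: nat set)" "{0} \<subseteq> {..<1::nat}" by auto
  then show ?case by (intro exI[of _ 1]) (auto simp: disjoint_family_on_def)
next
  case (Suc m)
  then obtain N where N: "\<forall>c :: nat set \<Rightarrow> nat. (\<forall>F. c F < r) \<longrightarrow>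
     (\<exists>A D. A \<noteq> {} \<and> A \<subseteq> {..<N} \<and> (\<forall>i<m. D i \<noteq> {} \<and> D i \<subseteq> {..<N} \<and> A \<inter> D i = {}) \<and>
        disjoint_family_on D {..<m} \<and> (\<forall>I\<subseteq>{..<m}. c (A \<union> \<Union>(D ` I)) = c A))"
    by (rule exE)
  let ?T = "Pow {..<N} \<rightarrow>\<^sub>E {..<r}"
  \<comment> \<open>There are \<open>L\<close> colourings of the subsets of \<open>{..<N}\<close>,
    so two of the \<open>L + 1\<close> interval lengths 0, ..., \<open>L\<close> must give the same
    one.\<close>
  define L where "L = card ?T"
  have finT: "finite ?T" by (simp add: finite_PiE)
  show ?case
  proof (intro exI[of _ "N + L"] allI impI)
    fix c :: "nat set \<Rightarrow> nat"
    assume c: "\<forall>F. c F < r"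
    define p where "p i = restrict (\<lambda>F. c (F \<union> {N..<N+i})) (Pow {..<N})" for i
    have "p ` {..L} \<subseteq> ?T"
      using c unfolding p_def by (intro image_subsetI restrict_PiE_iff[THEN iffD2]) simp
    then have "card (p ` {..L}) < card {..L}"
      using card_mono[OF finT, of "p ` {..L}"] by (simp add: L_def)
    then have "\<not> inj_on p {..L}" by (rule pigeonhole)
    then obtain i j where ij: "i < j" "j \<le> L" "p i = p j"
      by (metis atMost_iff linorder_inj_onI')
    have eq: "c (F \<union> {N..<N+i}) = c (F \<union> {N..<N+j})" if "F \<subseteq> {..<N}" for F
      using fun_cong[OF ij(3), of F] that by (simp add: p_def)
    \<comment> \<open>The induction hypothesis is used for the colouring that already includes the
      shorter interval, since \<open>A'\<close> will contain it.\<close>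
    obtain A D where A: "A \<noteq> {}" "A \<subseteq> {..<N}"
      and D[rule_format]: "\<forall>l<m. D l \<noteq> {} \<and> D l \<subseteq> {..<N} \<and> A \<inter> D l = {}"
      and disj: "disjoint_family_on D {..<m}"
      and mono[rule_format]: "\<forall>I\<subseteq>{..<m}. c (A \<union> \<Union>(D ` I) \<union> {N..<N+i}) = c (A \<union> {N..<N+i})"
      using N[rule_format, of "\<lambda>F. c (F \<union> {N..<N+i})", OF c[rule_format]]
      by (elim exE conjE) (rule that)
    define A' where "A' = A \<union> {N..<N+i}"
    \<comment> \<open>Adding direction \<open>m\<close> lengthens the appended interval from
      \<open>i\<close> to \<open>j\<close>, which \<open>eq\<close> shows to be invisible to
      \<open>c\<close>.\<close>
    define D' where "D' = D(m := {N+i..<N+j})"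
    have D'_less: "D' l = D l" if "l < m" for l using that by (simp add: D'_def)
    have D'_m: "D' m = {N+i..<N+j}" by (simp add: D'_def)
    have "A' \<noteq> {}" "A' \<subseteq> {..<N+L}" using A ij by (auto simp: A'_def)
    moreover have "D' l \<noteq> {} \<and> D' l \<subseteq> {..<N+L} \<and> A' \<inter> D' l = {}" if "l < Suc m" for l
    proof (cases "l = m")
      case True
      then show ?thesis using A ij by (auto simp: D'_m A'_def)
    next
      case False
      then have "l < m" using that by simp
      then show ?thesis using D[of l] by (fastforce simp: D'_less A'_def)
    qed
    moreover have "disjoint_family_on D' {..<Suc m}"
    proof -
      have "D' m \<inter> D' l = {}" if "l < m" for l
        using D[OF that] that by (fastforce simp: D'_less D'_m)
      moreover have "disjoint_family_on D' {..<m}"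
        using disj by (simp add: disjoint_family_on_def D'_less)
      ultimately show ?thesis
        unfolding lessThan_Suc by (subst disjoint_family_on_insert) auto
    qed
    moreover have "c (A' \<union> \<Union>(D' ` I)) = c A'" if I: "I \<subseteq> {..<Suc m}" for I
    proof -
      define J where "J = I - {m}"
      have J: "J \<subseteq> {..<m}" using I by (auto simp: J_def less_Suc_eq)
      have DJ: "\<Union>(D' ` J) = \<Union>(D ` J)" using J by (intro SUP_cong) (auto simp: D'_less)
      have sub: "A \<union> \<Union>(D ` J) \<subseteq> {..<N}" using A D J by blast
      have base: "c (A \<union> \<Union>(D ` J) \<union> {N..<N+i}) = c A'"
        using mono[OF J] by (simp add: A'_def)
      show ?thesis
      proof (cases "m \<in> I")
        case True
        then have "I = insert m J" by (auto simp: J_def)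
        moreover have "{N..<N+i} \<union> {N+i..<N+j} = {N..<N+j}" using ij by auto
        ultimately have "A' \<union> \<Union>(D' ` I) = A \<union> \<Union>(D ` J) \<union> {N..<N+j}"
          using DJ D'_m A'_def by auto
        then show ?thesis using eq[OF sub] base by simp
      next
        case False
        then have "I = J" by (auto simp: J_def)
        then have "A' \<union> \<Union>(D' ` I) = A \<union> \<Union>(D ` J) \<union> {N..<N+i}"
          using DJ A'_def by auto
        then show ?thesis using base by simp
      qed
    qed
    ultimately show "\<exists>A D. A \<noteq> {} \<and> A \<subseteq> {..<N + L} \<and>
        (\<forall>i<Suc m. D i \<noteq> {} \<and> D i \<subseteq> {..<N + L} \<and> A \<inter> D i = {}) \<and>
        disjoint_family_on D {..<Suc m} \<and> (\<forall>I\<subseteq>{..<Suc m}. c (A \<union> \<Union>(D ` I)) = c A)"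
      by blast
  qed
qed

text \<open>The family is built from its last member downwards. A Hilbert cube with many directions
  provides a base \<open>A\<close>, which becomes the last set. The earlier sets are unions of
  directions, so adding them to \<open>A\<close> does not change its colour; the induction
  hypothesis arranges them among themselves.\<close>

lemma union_colour_determined_by_max_index:
  fixes m :: nat
  shows "\<exists>N. \<forall>c :: nat set \<Rightarrow> nat. (\<forall>F. c F < r) \<longrightarrow>
     (\<exists>D. (\<forall>i<m. D i \<noteq> {} \<and> D i \<subseteq> {..<N}) \<and> disjoint_family_on D {..<m} \<and>
        (\<forall>n<m. \<forall>I\<subseteq>{..<n}. c (D n \<union> \<Union>(D ` I)) = c (D n)))"
proof (induction m)
  case 0
  then show ?case by (auto simp: disjoint_family_on_def)
next
  case (Suc m)
  then obtain N where N: "\<forall>c :: nat set \<Rightarrow> nat. (\<forall>F. c F < r) \<longrightarrow>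
     (\<exists>D. (\<forall>i<m. D i \<noteq> {} \<and> D i \<subseteq> {..<N}) \<and> disjoint_family_on D {..<m} \<and>
        (\<forall>n<m. \<forall>I\<subseteq>{..<n}. c (D n \<union> \<Union>(D ` I)) = c (D n)))"
    by (rule exE)
  obtain N' where N': "\<forall>c :: nat set \<Rightarrow> nat. (\<forall>F. c F < r) \<longrightarrow>
     (\<exists>A E. A \<noteq> {} \<and> A \<subseteq> {..<N'} \<and> (\<forall>i<N. E i \<noteq> {} \<and> E i \<subseteq> {..<N'} \<and> A \<inter> E i = {}) \<and>
        disjoint_family_on E {..<N} \<and> (\<forall>I\<subseteq>{..<N}. c (A \<union> \<Union>(E ` I)) = c A))"
    using hilbert_cube_disjoint_sets[of r N] by (rule exE)
  show ?case
  proof (intro exI[of _ N'] allI impI)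
    fix c :: "nat set \<Rightarrow> nat"
    assume c: "\<forall>F. c F < r"
    obtain A E where A: "A \<noteq> {}" "A \<subseteq> {..<N'}"
      and E[rule_format]: "\<forall>i<N. E i \<noteq> {} \<and> E i \<subseteq> {..<N'} \<and> A \<inter> E i = {}"
      and disjE: "disjoint_family_on E {..<N}"
      and AE[rule_format]: "\<forall>I\<subseteq>{..<N}. c (A \<union> \<Union>(E ` I)) = c A"
      using N'[rule_format, of c, OF c[rule_format]]
      by (elim exE conjE) (rule that)
    \<comment> \<open>The induction hypothesis is applied to index sets: the colour of
      \<open>F\<close> is that of the union of the directions \<open>E a\<close> with
      \<open>a\<close> in \<open>F\<close>. Hence each \<open>D i\<close> consists of indices, and
      \<open>D'\<close> translates it back.\<close>
    obtain D where D[rule_format]: "\<forall>i<m. D i \<noteq> {} \<and> D i \<subseteq> {..<N}"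
      and disjD: "disjoint_family_on D {..<m}"
      and DD[rule_format]: "\<forall>n<m. \<forall>I\<subseteq>{..<n}.
        c (\<Union>(E ` (D n \<union> \<Union>(D ` I)))) = c (\<Union>(E ` D n))"
      using N[rule_format, of "\<lambda>F. c (\<Union>(E ` F))", OF c[rule_format]]
      by (elim exE conjE) (rule that)
    define D' where "D' i = (if i < m then \<Union>(E ` D i) else A)" for i
    have D'_sub: "\<Union>(D' ` I) = \<Union>(E ` \<Union>(D ` I))" if "I \<subseteq> {..<m}" for I
      using that by (fastforce simp: D'_def)
    have "D' i \<noteq> {} \<and> D' i \<subseteq> {..<N'}" if "i < Suc m" for i
      using A D[of i] E by (auto simp: D'_def) (meson subsetD lessThan_iff ex_in_conv)+
    moreover have "disjoint_family_on D' {..<Suc m}"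
    proof -
      have "D' m \<inter> \<Union>(D' ` {..<m}) = {}"
        using D E by (fastforce simp: D'_def)
      moreover have "disjoint_family_on D' {..<m}"
        unfolding disjoint_family_on_def
      proof (intro ballI impI)
        fix i j assume ij: "i \<in> {..<m}" "j \<in> {..<m}" "i \<noteq> j"
        have "D i \<inter> D j = {}" using disjD ij by (auto simp: disjoint_family_on_def)
        then have "E a \<inter> E b = {}" if ab: "a \<in> D i" "b \<in> D j" for a b
        proof -
          have "a \<in> {..<N}" "b \<in> {..<N}" "a \<noteq> b"
            using ab D[of i] D[of j] ij \<open>D i \<inter> D j = {}\<close> by auto
          then show ?thesis by (rule disjoint_family_onD[OF disjE])
        qed
        then show "D' i \<inter> D' j = {}" using ij by (auto simp: D'_def)
      qed
      ultimately show ?thesis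
        unfolding lessThan_Suc by (subst disjoint_family_on_insert) auto
    qed
    moreover have "c (D' n \<union> \<Union>(D' ` I)) = c (D' n)" if "n < Suc m" "I \<subseteq> {..<n}" for n I
    proof (cases "n = m")
      case True
      then have "\<Union>(D ` I) \<subseteq> {..<N}" using D that by blast
      then have "c (A \<union> \<Union>(E ` \<Union>(D ` I))) = c A" by (rule AE)
      moreover have "D' n = A" "\<Union>(D' ` I) = \<Union>(E ` \<Union>(D ` I))"
        using D'_sub that(2) True by (simp_all add: D'_def)
      ultimately show ?thesis by (simp only:)
    next
      case False
      then have "n < m" using that by simp
      then have "I \<subseteq> {..<m}" using that by auto
      then have "\<Union>(D' ` I) = \<Union>(E ` \<Union>(D ` I))" by (rule D'_sub)
      moreover have "D' n = \<Union>(E ` D n)" using \<open>n < m\<close> by (simp add: D'_def)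
      ultimately show ?thesis
        using DD[OF \<open>n < m\<close> that(2)] by (simp only: image_Un Union_Un_distrib)
    qed
    ultimately show "\<exists>D. (\<forall>i<Suc m. D i \<noteq> {} \<and> D i \<subseteq> {..<N'}) \<and>
        disjoint_family_on D {..<Suc m} \<and>
        (\<forall>n<Suc m. \<forall>I\<subseteq>{..<n}. c (D n \<union> \<Union>(D ` I)) = c (D n))"
      by (intro exI[of _ D'] conjI allI impI; blast)
  qed
qed

text \<open>Among \<open>r*k\<close> sets from the previous lemma, some \<open>k\<close> have the
  same colour by pigeonhole. A union of some of these has the colour of its member of largest index,
  hence this common colour.\<close>

lemma finite_unions_disjoint_sets:
  fixes k :: nat
  shows "\<exists>N. \<forall>c :: nat set \<Rightarrow> nat. (\<forall>F. c F < r) \<longrightarrow>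
     (\<exists>D q. (\<forall>i\<in>{1..k}. D i \<noteq> {} \<and> D i \<subseteq> {..<N}) \<and> disjoint_family_on D {1..k} \<and>
        (\<forall>I\<subseteq>{1..k}. I \<noteq> {} \<longrightarrow> c (\<Union>(D ` I)) = q))"
proof -
  obtain N where N: "\<forall>c :: nat set \<Rightarrow> nat. (\<forall>F. c F < r) \<longrightarrow>
     (\<exists>D. (\<forall>i<r*k. D i \<noteq> {} \<and> D i \<subseteq> {..<N}) \<and> disjoint_family_on D {..<r*k} \<and>
        (\<forall>n<r*k. \<forall>I\<subseteq>{..<n}. c (D n \<union> \<Union>(D ` I)) = c (D n)))"
    using union_colour_determined_by_max_index[of r "r*k"] by (rule exE)
  show ?thesis
  proof (intro exI[of _ N] allI impI)
    fix c :: "nat set \<Rightarrow> nat"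
    assume c: "\<forall>F. c F < r"
    obtain D where D[rule_format]: "\<forall>i<r*k. D i \<noteq> {} \<and> D i \<subseteq> {..<N}"
      and disj: "disjoint_family_on D {..<r*k}"
      and max[rule_format]: "\<forall>n<r*k. \<forall>I\<subseteq>{..<n}. c (D n \<union> \<Union>(D ` I)) = c (D n)"
      using N[rule_format, of c, OF c[rule_format]]
      by (elim exE conjE) (rule that)
    \<comment> \<open>Positivity is needed to cancel the factor \<open>r\<close> in the pigeonhole
      bound.\<close>
    have "r > 0" using c by (metis gr_zeroI not_less_zero)
    then obtain q where q: "card {..<r*k} \<le> card ((\<lambda>n. c (D n)) -` {q} \<inter> {..<r*k}) * card {..<r}"
      using pigeonhole_card[of "\<lambda>n. c (D n)" "{..<r*k}" "{..<r}"] c by auto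
    then have "k \<le> card ((\<lambda>n. c (D n)) -` {q} \<inter> {..<r*k})"
      using \<open>r > 0\<close> by (simp add: mult.commute)
    then obtain T where T: "T \<subseteq> (\<lambda>n. c (D n)) -` {q} \<inter> {..<r*k}" "card T = k" "finite T"
      by (meson obtain_subset_with_card_n)
    obtain f where f: "bij_betw f {1..k} T"
      using ex_bij_betw_nat_finite_1[OF T(3)] T(2) by blast
    have fT: "f i \<in> T" if "i \<in> {1..k}" for i using f that by (auto simp: bij_betw_def)
    have less: "f i < r*k" if "i \<in> {1..k}" for i using fT[OF that] T(1) by auto
    have "D (f i) \<noteq> {} \<and> D (f i) \<subseteq> {..<N}" if "i \<in> {1..k}" for i
      by (rule D[OF less[OF that]])
    moreover have "disjoint_family_on (\<lambda>i. D (f i)) {1..k}"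
      unfolding disjoint_family_on_def
    proof (intro ballI impI)
      fix i j assume ij: "i \<in> {1..k}" "j \<in> {1..k}" "i \<noteq> j"
      then have "f i \<noteq> f j" using bij_betw_imp_inj_on[OF f] by (metis inj_onD)
      then show "D (f i) \<inter> D (f j) = {}"
        using less ij(1,2) by (intro disjoint_family_onD[OF disj]) simp_all
    qed
    moreover have "c (\<Union>i\<in>I. D (f i)) = q" if I: "I \<subseteq> {1..k}" "I \<noteq> {}" for I
    proof -
      let ?J = "f ` I"
      have J: "?J \<subseteq> T" "?J \<noteq> {}" using I fT by auto
      then have finJ: "finite ?J" using T(3) finite_subset by blast
      define n where "n = Max ?J"
      have n: "n \<in> ?J" using Max_in[OF finJ J(2)] by (simp add: n_def)
      have "?J - {n} \<subseteq> {..<n}" using Max_ge[OF finJ] by (fastforce simp: n_def)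
      then have "c (D n \<union> \<Union>(D ` (?J - {n}))) = c (D n)"
        using subsetD[OF T(1) subsetD[OF J(1) n]] by (intro max) auto
      moreover have "D n \<union> \<Union>(D ` (?J - {n})) = (\<Union>i\<in>I. D (f i))" using n by auto
      moreover have "c (D n) = q" using subsetD[OF T(1) subsetD[OF J(1) n]] by simp
      ultimately show ?thesis by simp
    qed
    ultimately show "\<exists>D q. (\<forall>i\<in>{1..k}. D i \<noteq> {} \<and> D i \<subseteq> {..<N}) \<and>
        disjoint_family_on D {1..k} \<and> (\<forall>I\<subseteq>{1..k}. I \<noteq> {} \<longrightarrow> c (\<Union>(D ` I)) = q)"
      by (intro exI[of _ "\<lambda>i. D (f i)"] exI[of _ q] conjI ballI allI impI; blast)
  qed
qed

text \<open>Folkman's theorem: colour a finite set by the colour of its cardinality, so that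
  disjoint unions turn into sums. The bound on the total is kept because the sizes must later be
  realised inside a set of \<open>K\<close> elements.\<close>

corollary folkman_nat:
  fixes k :: nat
  shows "\<exists>K. \<forall>\<chi> :: nat \<Rightarrow> nat. (\<forall>n. \<chi> n < r) \<longrightarrow>
     (\<exists>s q. (\<forall>i\<in>{1..k}. s i > 0) \<and> sum s {1..k} \<le> K \<and>
        (\<forall>I\<subseteq>{1..k}. I \<noteq> {} \<longrightarrow> \<chi> (sum s I) = q))"
proof -
  obtain N where N: "\<forall>c :: nat set \<Rightarrow> nat. (\<forall>F. c F < r) \<longrightarrow>
     (\<exists>D q. (\<forall>i\<in>{1..k}. D i \<noteq> {} \<and> D i \<subseteq> {..<N}) \<and> disjoint_family_on D {1..k} \<and>
        (\<forall>I\<subseteq>{1..k}. I \<noteq> {} \<longrightarrow> c (\<Union>(D ` I)) = q))"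
    using finite_unions_disjoint_sets[of r k] by (rule exE)
  show ?thesis
  proof (intro exI[of _ N] allI impI)
    fix \<chi> :: "nat \<Rightarrow> nat"
    assume c: "\<forall>n. \<chi> n < r"
    obtain D q where D[rule_format]: "\<forall>i\<in>{1..k}. D i \<noteq> {} \<and> D i \<subseteq> {..<N}"
      and disj: "disjoint_family_on D {1..k}"
      and q[rule_format]: "\<forall>I\<subseteq>{1..k}. I \<noteq> {} \<longrightarrow> \<chi> (card (\<Union>(D ` I))) = q"
      using N[rule_format, of "\<lambda>F. \<chi> (card F)", OF c[rule_format]]
      by (elim exE conjE) (rule that)
    have fin: "finite (D i)" if "i \<in> {1..k}" for i
      using D[OF that] finite_subset by blast
    have card: "card (\<Union>(D ` I)) = (\<Sum>i\<in>I. card (D i))" if I: "I \<subseteq> {1..k}" for I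
    proof (rule card_UN_disjoint)
      show "finite I" using I finite_subset by blast
      show "\<forall>i\<in>I. finite (D i)" using I fin by blast
      show "\<forall>i\<in>I. \<forall>j\<in>I. i \<noteq> j \<longrightarrow> D i \<inter> D j = {}"
        using I disj unfolding disjoint_family_on_def by blast
    qed
    have "card (\<Union>(D ` {1..k})) \<le> card {..<N}" by (intro card_mono) (use D in blast)+
    then have "(\<Sum>i\<in>{1..k}. card (D i)) \<le> N" using card by simp
    moreover have "card (D i) > 0" if "i \<in> {1..k}" for i
      using D fin that by (simp add: card_gt_0_iff)
    moreover have "\<chi> (\<Sum>i\<in>I. card (D i)) = q" if "I \<subseteq> {1..k}" "I \<noteq> {}" for I
      using q[OF that] card[OF that(1)] by simp
    ultimately show "\<exists>s q. (\<forall>i\<in>{1..k}. s i > 0) \<and> sum s {1..k} \<le> N \<and>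
        (\<forall>I\<subseteq>{1..k}. I \<noteq> {} \<longrightarrow> \<chi> (sum s I) = q)"
      by (intro exI[of _ "\<lambda>i. card (D i)"] exI[of _ q] conjI ballI allI impI; blast)
  qed
qed

section \<open>Finite unions of consecutive blocks\<close>

lemma strict_mono_enumeration:
  assumes "finite (H :: nat set)"
  obtains h where "strict_mono_on {..<card H} h" "h ` {..<card H} = H"
proof
  let ?h = "\<lambda>i. sorted_list_of_set H ! i"
  show "strict_mono_on {..<card H} ?h"
    using strict_sorted_list_of_set[of H]
    by (auto simp: strict_mono_on_def sorted_wrt_iff_nth_less)
  show "?h ` {..<card H} = H"
    using assms nth_image[of "card H" "sorted_list_of_set H"]
    by (simp add: lessThan_atLeast0)
qed

text \<open>Induction on the largest cardinality \<open>K\<close> treated: Ramsey's theorem for sets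
  of size \<open>Suc K\<close> gives a homogeneous set large enough for the induction hypothesis,
  which then handles the smaller sizes inside it. The map \<open>h\<close> is increasing so that
  blocks keep their order.\<close>

lemma simultaneous_ramsey:
  fixes M :: nat
  shows "\<exists>N. \<forall>c :: nat set \<Rightarrow> nat. (\<forall>F. c F < r) \<longrightarrow>
     (\<exists>h. strict_mono_on {..<M} h \<and> h ` {..<M} \<subseteq> {..<N} \<and>
        (\<forall>F\<subseteq>{..<M}. \<forall>G\<subseteq>{..<M}. card F = card G \<longrightarrow> card F \<le> K \<longrightarrow> c (h ` F) = c (h ` G)))"
proof (induction K)
  case 0
  have "c (id ` F) = c (id ` G)"
    if "F \<subseteq> {..<M}" "G \<subseteq> {..<M}" "card F = card G" "card F \<le> 0" for c :: "nat set \<Rightarrow> nat" and F G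
    using that by (metis card_0_eq finite_lessThan finite_subset le_zero_eq)
  then show ?case
    by (intro exI[of _ M] allI impI exI[of _ id]) (auto simp: strict_mono_on_def)
next
  case (Suc K)
  then obtain N where N: "\<forall>c :: nat set \<Rightarrow> nat. (\<forall>F. c F < r) \<longrightarrow>
     (\<exists>h. strict_mono_on {..<M} h \<and> h ` {..<M} \<subseteq> {..<N} \<and>
        (\<forall>F\<subseteq>{..<M}. \<forall>G\<subseteq>{..<M}. card F = card G \<longrightarrow> card F \<le> K \<longrightarrow> c (h ` F) = c (h ` G)))"
    by (rule exE)
  \<comment> \<open>The list asks for a homogeneous set of the same size \<open>N\<close> in each of
    the \<open>r\<close> colours.\<close>
  obtain N' :: nat where N': "partn_lst {..<N'} (replicate r N) (Suc K)"
    using ramsey_full by blast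
  show ?case
  proof (intro exI[of _ N'] allI impI)
    fix c :: "nat set \<Rightarrow> nat"
    assume c: "\<forall>F. c F < r"
    have "c \<in> nsets {..<N'} (Suc K) \<rightarrow> {..<r}" using c by auto
    then obtain i H where iH: "i < length (replicate r N)"
      "H \<in> nsets {..<N'} (replicate r N ! i)" "c ` nsets H (Suc K) \<subseteq> {i}"
      by (rule partn_lstE[OF N']) auto
    then have H: "H \<subseteq> {..<N'}" "finite H" "card H = N" by (auto simp: nsets_def)
    obtain g where g: "strict_mono_on {..<N} g" "g ` {..<N} = H"
      using strict_mono_enumeration[OF H(2)] H(3) by metis
    obtain h where h: "strict_mono_on {..<M} h" "h ` {..<M} \<subseteq> {..<N}"
      and hc[rule_format]: "\<forall>F\<subseteq>{..<M}. \<forall>G\<subseteq>{..<M}. card F = card G \<longrightarrow> card F \<le> K \<longrightarrow>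
        c (g ` h ` F) = c (g ` h ` G)"
      using N[rule_format, of "\<lambda>F. c (g ` F)", OF c[rule_format]]
      \<comment> \<open>The colouring is pulled back along \<open>g\<close>, which identifies
        \<open>{..<N}\<close> with the homogeneous set \<open>H\<close>.\<close>
      by (elim exE conjE) (rule that)
    have gh: "strict_mono_on {..<M} (g \<circ> h)"
      using g(1) h unfolding strict_mono_on_def by (auto simp: image_subset_iff)
    have sub: "(g \<circ> h) ` {..<M} \<subseteq> H" using g(2) h(2) by (auto simp: image_subset_iff)
    have top: "c ((g \<circ> h) ` F) = i" if F: "F \<subseteq> {..<M}" "card F = Suc K" for F
    proof -
      have "card ((g \<circ> h) ` F) = Suc K"
        using F strict_mono_on_imp_inj_on[OF gh] by (metis card_image inj_on_subset)
      moreover have "(g \<circ> h) ` F \<subseteq> H" using F sub by blast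
      ultimately have "(g \<circ> h) ` F \<in> nsets H (Suc K)"
        using H(2) finite_subset by (auto simp: nsets_def)
      then show ?thesis using iH(3) by blast
    qed
    have "c ((g \<circ> h) ` F) = c ((g \<circ> h) ` G)"
      if "F \<subseteq> {..<M}" "G \<subseteq> {..<M}" "card F = card G" "card F \<le> Suc K" for F G
    proof (cases "card F = Suc K")
      case True
      then show ?thesis using top that by metis
    next
      case False
      then show ?thesis using hc[of F G] that by (simp add: image_comp)
    qed
    then show "\<exists>h. strict_mono_on {..<M} h \<and> h ` {..<M} \<subseteq> {..<N'} \<and>
        (\<forall>F\<subseteq>{..<M}. \<forall>G\<subseteq>{..<M}. card F = card G \<longrightarrow> card F \<le> Suc K \<longrightarrow> c (h ` F) = c (h ` G))"
      using gh sub H(1) by (intro exI[of _ "g \<circ> h"]) blast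
  qed
qed

text \<open>On the image of \<open>h\<close> the colour depends only on cardinality, so Folkman's
  theorem supplies block sizes, and consecutive intervals of these sizes can serve as blocks. The
  shift by \<open>Suc\<close> moves \<open>{..<N}\<close> into \<open>{1..N}\<close>.\<close>

theorem finite_unions_blocks:
  fixes k :: nat
  shows "\<exists>N. \<forall>c :: nat set \<Rightarrow> nat. (\<forall>F. c F < r) \<longrightarrow>
     (\<exists>D q. (\<forall>i\<in>{1..k}. D i \<noteq> {} \<and> D i \<subseteq> {1..N}) \<and>
        (\<forall>i\<in>{1..k}. \<forall>j\<in>{1..k}. i < j \<longrightarrow> (\<forall>a\<in>D i. \<forall>b\<in>D j. a < b)) \<and>
        (\<forall>I\<subseteq>{1..k}. I \<noteq> {} \<longrightarrow> c (\<Union>(D ` I)) = q))"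
proof -
  obtain K where K: "\<forall>\<chi> :: nat \<Rightarrow> nat. (\<forall>n. \<chi> n < r) \<longrightarrow>
     (\<exists>s q. (\<forall>i\<in>{1..k}. s i > 0) \<and> sum s {1..k} \<le> K \<and>
        (\<forall>I\<subseteq>{1..k}. I \<noteq> {} \<longrightarrow> \<chi> (sum s I) = q))"
    using folkman_nat[of r k] by (rule exE)
  obtain N where N: "\<forall>c :: nat set \<Rightarrow> nat. (\<forall>F. c F < r) \<longrightarrow>
     (\<exists>h. strict_mono_on {..<K} h \<and> h ` {..<K} \<subseteq> {..<N} \<and>
        (\<forall>F\<subseteq>{..<K}. \<forall>G\<subseteq>{..<K}. card F = card G \<longrightarrow> card F \<le> K \<longrightarrow> c (h ` F) = c (h ` G)))"
    using simultaneous_ramsey[of r K K] by (rule exE)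
  show ?thesis
  proof (intro exI[of _ N] allI impI)
    fix c :: "nat set \<Rightarrow> nat"
    assume c: "\<forall>F. c F < r"
    obtain h where h: "strict_mono_on {..<K} h" "h ` {..<K} \<subseteq> {..<N}"
      and hc[rule_format]: "\<forall>F\<subseteq>{..<K}. \<forall>G\<subseteq>{..<K}. card F = card G \<longrightarrow> card F \<le> K \<longrightarrow>
        c (Suc ` h ` F) = c (Suc ` h ` G)"
      using N[rule_format, of "\<lambda>F. c (Suc ` F)", OF c[rule_format]]
      by (elim exE conjE) (rule that)
    \<comment> \<open>The colour of a size \<open>n\<close> is read off the initial segment
      \<open>{..<n}\<close> as its representative.\<close>
    obtain s q where s[rule_format]: "\<forall>i\<in>{1..k}. s i > 0" "sum s {1..k} \<le> K"
      and q[rule_format]: "\<forall>I\<subseteq>{1..k}. I \<noteq> {} \<longrightarrow> c (Suc ` h ` {..<sum s I}) = q"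
      using K[rule_format, of "\<lambda>n. c (Suc ` h ` {..<n})", OF c[rule_format]]
      by (elim exE conjE) (rule that)
    \<comment> \<open>These are consecutive intervals of lengths \<open>s 1\<close>, ...,
      \<open>s k\<close>, starting at 0.\<close>
    define E where "E i = {sum s {1..<i}..<sum s {1..i}}" for i
    define D where "D i = Suc ` h ` E i" for i
    have E_sum: "sum s {1..i} = sum s {1..<i} + s i" if "i \<in> {1..k}" for i
      using that by (simp add: sum.last_plus)
    have cardE: "card (E i) = s i" if "i \<in> {1..k}" for i
      using E_sum[OF that] by (simp add: E_def)
    have E_sub: "E i \<subseteq> {..<K}" if "i \<in> {1..k}" for i
    proof -
      have "sum s {1..i} \<le> sum s {1..k}" using that by (intro sum_mono2) auto
      then show ?thesis using s(2) by (auto simp: E_def)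
    qed
    have E_less: "a < b" if "i < j" "a \<in> E i" "b \<in> E j" for i j a b
    proof -
      have "sum s {1..i} \<le> sum s {1..<j}" using that by (intro sum_mono2) auto
      then show ?thesis using that by (auto simp: E_def)
    qed
    have "D i \<noteq> {} \<and> D i \<subseteq> {1..N}" if "i \<in> {1..k}" for i
    proof
      have "E i \<noteq> {}" using cardE[OF that] s(1)[OF that] by auto
      then show "D i \<noteq> {}" by (simp add: D_def)
      show "D i \<subseteq> {1..N}"
        using E_sub[OF that] h(2) by (fastforce simp: D_def)
    qed
    moreover have "a < b" if ij: "i \<in> {1..k}" "j \<in> {1..k}" "i < j" and ab: "a \<in> D i" "b \<in> D j" for i j a b
    proof -
      obtain a' b' where "a' \<in> E i" "b' \<in> E j" "a = Suc (h a')" "b = Suc (h b')"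
        using ab by (auto simp: D_def)
      moreover from this have "a' < b'" "a' \<in> {..<K}" "b' \<in> {..<K}"
        using E_less ij E_sub by blast+
      ultimately show ?thesis using h(1) by (simp add: strict_mono_on_def)
    qed
    moreover have "c (\<Union>(D ` I)) = q" if I: "I \<subseteq> {1..k}" "I \<noteq> {}" for I
    proof -
      have "card (\<Union>(E ` I)) = (\<Sum>i\<in>I. card (E i))"
      proof (rule card_UN_disjoint)
        show "finite I" using I finite_subset by blast
        show "\<forall>i\<in>I. finite (E i)" by (simp add: E_def)
        show "\<forall>i\<in>I. \<forall>j\<in>I. i \<noteq> j \<longrightarrow> E i \<inter> E j = {}"
          using E_less by (metis disjoint_iff less_irrefl nat_neq_iff)
      qed
      also have "\<dots> = sum s I" using I cardE by (intro sum.cong) auto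
      finally have card: "card (\<Union>(E ` I)) = sum s I" .
      have "sum s I \<le> sum s {1..k}" using I by (intro sum_mono2) auto
      then have le: "sum s I \<le> K" using s(2) by simp
      have "\<Union>(D ` I) = Suc ` h ` \<Union>(E ` I)" by (auto simp: D_def)
      \<comment> \<open>A union of intervals may have gaps, but it has the same cardinality as the
        initial segment.\<close>
      moreover have "c (Suc ` h ` \<Union>(E ` I)) = c (Suc ` h ` {..<sum s I})"
        by (rule hc) (use card le E_sub I in \<open>auto, blast\<close>)
      ultimately show ?thesis using q[OF I] by simp
    qed
    ultimately show "\<exists>D q. (\<forall>i\<in>{1..k}. D i \<noteq> {} \<and> D i \<subseteq> {1..N}) \<and>
        (\<forall>i\<in>{1..k}. \<forall>j\<in>{1..k}. i < j \<longrightarrow> (\<forall>a\<in>D i. \<forall>b\<in>D j. a < b)) \<and>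
        (\<forall>I\<subseteq>{1..k}. I \<noteq> {} \<longrightarrow> c (\<Union>(D ` I)) = q)"
      by (intro exI[of _ D] exI[of _ q] conjI ballI allI impI; blast)
  qed
qed

section \<open>Sums over blocks\<close>

lemma ordered_sum_singleton [simp]: "ordered_sum x {t} = x t"
  by (simp add: ordered_sum_def)

lemma foldl_add_assoc:
  "foldl (\<lambda>s t. s + x t) (a + b) ts = a + foldl (\<lambda>s t. s + x t) (b :: 'a::semigroup_add) ts"
  by (induction ts arbitrary: b) (auto simp: add.assoc)

text \<open>Since \<open>F\<close> precedes \<open>G\<close>, the sorted lists are concatenated, and
  associativity alone separates the two sums.\<close>

lemma ordered_sum_Un:
  assumes "finite F" "F \<noteq> {}" "finite G" "G \<noteq> {}" and less: "\<And>a b. a \<in> F \<Longrightarrow> b \<in> G \<Longrightarrow> a < b"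
  shows "ordered_sum x (F \<union> G) = ordered_sum x F + ordered_sum x G"
proof -
  have app: "sorted_list_of_set (F \<union> G) = sorted_list_of_set F @ sorted_list_of_set G"
    using assms
    by (intro sorted_distinct_set_unique) (auto simp: sorted_append intro: less_imp_le dest: less)
  obtain f fs where f: "sorted_list_of_set F = f # fs"
    using assms by (cases "sorted_list_of_set F") auto
  obtain g gs where g: "sorted_list_of_set G = g # gs"
    using assms by (cases "sorted_list_of_set G") auto
  show ?thesis by (simp add: ordered_sum_def app f g foldl_add_assoc)
qed

text \<open>Induction adding the largest index: its block lies after all earlier ones, so both sides
  split off the same last summand.\<close>

lemma ordered_sum_blocks:
  assumes "finite I" "I \<noteq> {}"
    and "\<And>i. i \<in> I \<Longrightarrow> finite (D i) \<and> D i \<noteq> {}"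
    and "\<And>i j a b. i \<in> I \<Longrightarrow> j \<in> I \<Longrightarrow> i < j \<Longrightarrow> a \<in> D i \<Longrightarrow> b \<in> D j \<Longrightarrow> a < b"
  shows "ordered_sum (\<lambda>i. ordered_sum x (D i)) I = ordered_sum x (\<Union>(D ` I))"
  using assms
proof (induction I rule: finite_linorder_max_induct)
  case empty
  then show ?case by simp
next
  case (insert m I)
  let ?y = "\<lambda>i. ordered_sum x (D i)"
  show ?case
  proof (cases "I = {}")
    case True
    then show ?thesis by simp
  next
    case False
    have "ordered_sum ?y (I \<union> {m}) = ordered_sum ?y I + ordered_sum ?y {m}"
      using insert False by (intro ordered_sum_Un) auto
    also have "ordered_sum ?y I = ordered_sum x (\<Union>(D ` I))"
      by (intro insert.IH False) (use insert.prems in blast)+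
    also have "\<dots> + ordered_sum ?y {m} = ordered_sum x (\<Union>(D ` I) \<union> D m)"
    proof -
      have "\<Union>(D ` I) \<noteq> {}" using insert.prems(2) False by blast
      then show ?thesis
        using insert.hyps insert.prems
        by (subst ordered_sum_Un) (auto, blast)
    qed
    finally show ?thesis by (simp add: Un_commute)
  qed
qed

section \<open>Summability along blocks and partition regularity\<close>

lemma k_summable_le:
  assumes "k_summable k A" "l \<le> k"
  shows "k_summable l A"
proof -
  have "{1..l} \<subseteq> {1..k}" using assms(2) by auto
  then show ?thesis
    using assms(1) unfolding k_summable_def unique_finite_sums_def by (meson subset_trans)
qed

text \<open>Uniqueness is inherited in two stages: equal sums force equal unions of blocks by
  uniqueness for \<open>x\<close>, and the union determines the index set because the blocks are
  nonempty and pairwise disjoint.\<close>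

lemma k_summable_blocks:
  assumes x: "unique_finite_sums n x"
    and D: "\<And>i. i \<in> {1..k} \<Longrightarrow> D i \<noteq> {} \<and> D i \<subseteq> {1..n}"
    and less: "\<And>i j a b. i \<in> {1..k} \<Longrightarrow> j \<in> {1..k} \<Longrightarrow> i < j \<Longrightarrow> a \<in> D i \<Longrightarrow> b \<in> D j \<Longrightarrow> a < b"
    and A: "\<And>I. I \<subseteq> {1..k} \<Longrightarrow> I \<noteq> {} \<Longrightarrow> ordered_sum x (\<Union>(D ` I)) \<in> A"
  shows "k_summable k A"
proof -
  let ?y = "\<lambda>i. ordered_sum x (D i)"
  have sum: "ordered_sum ?y I = ordered_sum x (\<Union>(D ` I))" if I: "I \<subseteq> {1..k}" "I \<noteq> {}" for I
  proof (rule ordered_sum_blocks)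
    show "finite I" using I finite_subset by blast
    show "finite (D i) \<and> D i \<noteq> {}" if "i \<in> I" for i
      using D[of i] I that finite_subset[of "D i" "{1..n}"] by blast
  qed (use I less in blast)+
  have sub: "I \<subseteq> J" if IJ: "I \<subseteq> {1..k}" "J \<subseteq> {1..k}" "\<Union>(D ` I) = \<Union>(D ` J)" for I J
  proof
    fix i assume "i \<in> I"
    then obtain a where a: "a \<in> D i" using D IJ by blast
    then obtain j where j: "j \<in> J" "a \<in> D j" using IJ(3) \<open>i \<in> I\<close> by blast
    \<comment> \<open>If \<open>a\<close> lay in two different blocks, their order would give
      \<open>a < a\<close>.\<close>
    have "i = j"
      using less[of i j a a] less[of j i a a] a j \<open>i \<in> I\<close> IJ
      by (metis less_irrefl nat_neq_iff subsetD)
    then show "i \<in> J" using j by simp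
  qed
  have "unique_finite_sums k ?y"
    unfolding unique_finite_sums_def
  proof (intro allI impI)
    fix F H
    assume F: "F \<noteq> {}" "F \<subseteq> {1..k}" and H: "H \<noteq> {}" "H \<subseteq> {1..k}"
      and eq: "ordered_sum ?y F = ordered_sum ?y H"
    have "\<Union>(D ` I) \<noteq> {} \<and> \<Union>(D ` I) \<subseteq> {1..n}" if "I \<noteq> {}" "I \<subseteq> {1..k}" for I
      using D that by blast
    then have "\<Union>(D ` F) = \<Union>(D ` H)"
      using x eq F H sum unfolding unique_finite_sums_def by metis
    then show "F = H" using sub F H by (metis subset_antisym)
  qed
  then show ?thesis
    unfolding k_summable_def using sum A by (intro exI[of _ ?y]) simp
qed

text \<open>If every piece failed at some length, all would fail at one common length
  \<open>k\<close>. Colouring index sets by a piece containing their sum then yields blocks that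
  make one piece \<open>k\<close>-summable.\<close>

lemma finite_FS_big_UN:
  fixes B :: "nat \<Rightarrow> 'a::semigroup_add set"
  assumes big: "finite_FS_big (\<Union>i\<in>{1..r}. B i)"
  shows "\<exists>i\<in>{1..r}. finite_FS_big (B i)"
proof (rule ccontr)
  assume "\<not> ?thesis"
  then obtain \<kappa> where \<kappa>: "\<And>i. i \<in> {1..r} \<Longrightarrow> \<kappa> i \<ge> 1 \<and> \<not> k_summable (\<kappa> i) (B i)"
    unfolding finite_FS_big_def by metis
  \<comment> \<open>The sum dominates every \<open>\<kappa> i\<close>; the successor makes
    \<open>{1..k}\<close> nonempty, from which \<open>q\<close> is later seen to be the index of a
    piece.\<close>
  define k where "k = Suc (sum \<kappa> {1..r})"
  have not: "\<not> k_summable k (B i)" if "i \<in> {1..r}" for i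
  proof -
    have "\<kappa> i \<le> k" using member_le_sum[of i "{1..r}" \<kappa>] that by (simp add: k_def)
    then show ?thesis using k_summable_le \<kappa>[OF that] by blast
  qed
  obtain N where N: "\<forall>c :: nat set \<Rightarrow> nat. (\<forall>F. c F < Suc r) \<longrightarrow>
     (\<exists>D q. (\<forall>i\<in>{1..k}. D i \<noteq> {} \<and> D i \<subseteq> {1..N}) \<and>
        (\<forall>i\<in>{1..k}. \<forall>j\<in>{1..k}. i < j \<longrightarrow> (\<forall>a\<in>D i. \<forall>b\<in>D j. a < b)) \<and>
        (\<forall>I\<subseteq>{1..k}. I \<noteq> {} \<longrightarrow> c (\<Union>(D ` I)) = q))"
    using finite_unions_blocks[of "Suc r" k] by (rule exE)
  have "k_summable N (\<Union>i\<in>{1..r}. B i)"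
    \<comment> \<open>Bigness speaks only of positive lengths, so \<open>Suc N\<close> covers the
      case that \<open>N\<close> is 0.\<close>
    using big k_summable_le[of "Suc N" _ N] by (auto simp: finite_FS_big_def)
  then obtain x where x: "unique_finite_sums N x"
    and xB: "\<And>F. F \<noteq> {} \<Longrightarrow> F \<subseteq> {1..N} \<Longrightarrow> ordered_sum x F \<in> (\<Union>i\<in>{1..r}. B i)"
    unfolding k_summable_def by blast
  \<comment> \<open>The colouring must be total: \<open>Suc r\<close> colours admit the indices 1,
    ..., \<open>r\<close> and leave 0 for sets that are empty or not contained in
    \<open>{1..N}\<close>.\<close>
  have "\<forall>F. \<exists>i. i < Suc r \<and> (F \<noteq> {} \<longrightarrow> F \<subseteq> {1..N} \<longrightarrow> i \<in> {1..r} \<and> ordered_sum x F \<in> B i)"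
  proof
    fix F
    show "\<exists>i. i < Suc r \<and> (F \<noteq> {} \<longrightarrow> F \<subseteq> {1..N} \<longrightarrow> i \<in> {1..r} \<and> ordered_sum x F \<in> B i)"
      using xB[of F] by (cases "F \<noteq> {} \<and> F \<subseteq> {1..N}") fastforce+
  qed
  then obtain c where c: "\<And>F. c F < Suc r"
    and cB: "\<And>F. F \<noteq> {} \<Longrightarrow> F \<subseteq> {1..N} \<Longrightarrow> c F \<in> {1..r} \<and> ordered_sum x F \<in> B (c F)"
    by metis
  obtain D q where D[rule_format]: "\<forall>i\<in>{1..k}. D i \<noteq> {} \<and> D i \<subseteq> {1..N}"
    and less[rule_format]: "\<forall>i\<in>{1..k}. \<forall>j\<in>{1..k}. i < j \<longrightarrow> (\<forall>a\<in>D i. \<forall>b\<in>D j. a < b)"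
    and q[rule_format]: "\<forall>I\<subseteq>{1..k}. I \<noteq> {} \<longrightarrow> c (\<Union>(D ` I)) = q"
    using N[rule_format, of c, OF c[rule_format]]
      by (elim exE conjE) (rule that)
  have qB: "q \<in> {1..r} \<and> ordered_sum x (\<Union>(D ` I)) \<in> B q" if I: "I \<subseteq> {1..k}" "I \<noteq> {}" for I
  proof -
    have "\<Union>(D ` I) \<noteq> {}" "\<Union>(D ` I) \<subseteq> {1..N}" using D I by blast+
    then show ?thesis using cB q[OF I] by metis
  qed
  have "k_summable k (B q)"
  proof (rule k_summable_blocks[OF x D])
    show "a < b" if "i \<in> {1..k}" "j \<in> {1..k}" "i < j" "a \<in> D i" "b \<in> D j" for i j a b
      by (rule less[OF that])
    show "ordered_sum x (\<Union>(D ` I)) \<in> B q" if "I \<subseteq> {1..k}" "I \<noteq> {}" for I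
      using qB[OF that] by simp
  qed
  moreover have "q \<in> {1..r}" using qB[of "{1..k}"] by (simp add: k_def)
  ultimately show False using not by blast
qed

theorem theorem4:
  "partition_regular {A :: 'a::semigroup_add set. finite_FS_big A} \<and>
   (\<forall>(A :: 'a set) (r :: nat) (B :: nat \<Rightarrow> 'a set).
      finite_FS_big A \<longrightarrow> 1 \<le> r \<longrightarrow> A = (\<Union>i\<in>{1..r}. B i) \<longrightarrow>
      (\<exists>i\<in>{1..r}. finite_FS_big (B i)))"
proof
  show "partition_regular {A :: 'a set. finite_FS_big A}"
    unfolding partition_regular_def
  proof (intro ballI allI impI)
    fix A :: "'a set" and P
    assume A: "A \<in> {A. finite_FS_big A}" and P: "finite P" "partition_on A P"
    \<comment> \<open>Enumerating the parts reduces set partitions to indexed unions.\<close>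
    obtain B where B: "bij_betw B {1..card P} P"
      using ex_bij_betw_nat_finite_1[OF P(1)] by blast
    then have "(\<Union>i\<in>{1..card P}. B i) = A"
      using P(2) by (simp add: bij_betw_def partition_on_def)
    then obtain i where "i \<in> {1..card P}" "finite_FS_big (B i)"
      using finite_FS_big_UN[where B = B and r = "card P"] A by auto
    then show "\<exists>C\<in>P. C \<in> {A. finite_FS_big A}" using B by (auto simp: bij_betw_def)
  qed
qed (use finite_FS_big_UN in blast)

end
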